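(* If $K$ is a compact metric space then for the generic $f\in C(K)$ $$\dim_H\operatorname{graph}(f)=\dim_H K.$$
   Context: $C(K)$ is the space of continuous functions $K\to\mathbb{R}$ with the supremum metric. "The generic $f\in C(K)$ has property $P$" means that the set of $f\in C(K)$ having $P$ is co-meager (its complement is a countable union of nowhere dense sets). $\operatorname{graph}(f)=\{(x,f(x)):x\in K\}\subseteq K\times\mathbb{R}$, where $K\times\mathbb{R}$ has the metric $\sqrt{d_K(x_1,x_2)^2+|y_1-y_2|^2}$. $\dim_H$ is Hausdorff dimension, with the convention $\dim_H\emptyset=-1$; the value $\infty$ is allowed. *)

theory Defs
  imports "HOL-Analysis.Analysis"
begin

section \<open>Hausdorff measure and Hausdorff dimension\<close>

text \<open>
  The contribution of a covering set to the Hausdorff sum. The empty set contributes 0 and a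
  nonempty set contributes 1 for exponent 0, so that the 0-dimensional measure is the counting
  measure (note that \<^term>\<open>0 powr 0 = (0::real)\<close>).
\<close>

definition diam_powr :: "real \<Rightarrow> 'a::metric_space set \<Rightarrow> real" where
  "diam_powr s U = (if U = {} then 0 else if s = 0 then 1 else diameter U powr s)"

text \<open>
  Covers are indexed by the naturals; as the empty set is allowed as a member, this includes finite
  covers. Boundedness is required explicitly since \<^const>\<open>diameter\<close> is real-valued and
  meaningless on unbounded sets. If no admissible cover exists, the infimum is infinite.
\<close>

definition hausdorff_premeasure :: "real \<Rightarrow> real \<Rightarrow> 'a::metric_space set \<Rightarrow> ennreal" where
  "hausdorff_premeasure s \<delta> A =
     (INF U \<in> {U :: nat \<Rightarrow> 'a set. A \<subseteq> (\<Union>n. U n) \<and> (\<forall>n. bounded (U n) \<and> diameter (U n) \<le> \<delta>)}.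
        \<Sum>n. ennreal (diam_powr s (U n)))"

text \<open>
  The premeasure increases as \<open>\<delta>\<close> decreases, so the limit for \<open>\<delta>\<close> tending to 0 is a supremum.
\<close>

definition hausdorff_measure :: "real \<Rightarrow> 'a::metric_space set \<Rightarrow> ennreal" where
  "hausdorff_measure s A = (SUP \<delta> \<in> {0<..}. hausdorff_premeasure s \<delta> A)"

text \<open>
  In \<^typ>\<open>ereal\<close> the infimum of the empty set is \<open>\<infinity>\<close>.
\<close>

definition hausdorff_dim :: "'a::metric_space set \<Rightarrow> ereal" where
  "hausdorff_dim A =
     (if A = {} then -1 else INF s \<in> {s::real. 0 \<le> s \<and> hausdorff_measure s A = 0}. ereal s)"

section \<open>Baire category\<close>

definition nowhere_dense_in :: "'a topology \<Rightarrow> 'a set \<Rightarrow> bool" where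
  "nowhere_dense_in X S \<longleftrightarrow> S \<subseteq> topspace X \<and> X interior_of (X closure_of S) = {}"

definition meagre_in :: "'a topology \<Rightarrow> 'a set \<Rightarrow> bool" where
  "meagre_in X S \<longleftrightarrow> (\<exists>N :: nat \<Rightarrow> 'a set. (\<forall>n. nowhere_dense_in X (N n)) \<and> S = (\<Union>n. N n))"

definition comeagre_in :: "'a topology \<Rightarrow> 'a set \<Rightarrow> bool" where
  "comeagre_in X S \<longleftrightarrow> S \<subseteq> topspace X \<and> meagre_in X (topspace X - S)"

section \<open>Continuous functions and their graphs\<close>

text \<open>
  The space \<open>C(K)\<close> with the supremum metric. Its points are the functions that are continuous on
  \<open>K\<close> and \<^const>\<open>undefined\<close> outside \<open>K\<close> (so that they are determined by their values on \<open>K\<close>);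
  \<^const>\<open>cfunspace\<close> also requires them to be bounded, which is automatic for compact \<open>K\<close>.
\<close>

definition C_metric :: "'a::metric_space set \<Rightarrow> ('a \<Rightarrow> real) metric" where
  "C_metric K = cfunspace (top_of_set K) (euclidean_metric :: real metric)"

text \<open>
  The distance of the product type \<open>'a \<times> real\<close> is
  \<open>dist (x, y) (x', y') = sqrt ((dist x x')\<^sup>2 + (dist y y')\<^sup>2)\<close>.
\<close>

definition graph_on :: "'a set \<Rightarrow> ('a \<Rightarrow> real) \<Rightarrow> ('a \<times> real) set" where
  "graph_on K f = {(x, f x) | x. x \<in> K}"

definition generic_in_C :: "'a::metric_space set \<Rightarrow> (('a \<Rightarrow> real) \<Rightarrow> bool) \<Rightarrow> bool" where
  "generic_in_C K P \<longleftrightarrow>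
     comeagre_in (mtopology_of (C_metric K)) {f \<in> mspace (C_metric K). P f}"

end

theory Submission
  imports Defs
begin

text \<open>
  The projection of the graph of \<open>f\<close> onto \<open>K\<close> is Lipschitz, so \<open>dim graph f \<ge> dim K\<close> holds for
  every \<open>f\<close>. Conversely let \<open>H\<^sup>s(K) = 0\<close>. If \<open>g\<close> is Lipschitz, then so is \<open>x \<mapsto> (x, g x)\<close>, hence
  \<open>H\<^sup>s(graph g) = 0\<close> and the compact set \<open>graph g\<close> has a neighbourhood that admits covers with
  arbitrarily small Hausdorff sums. This neighbourhood contains \<open>graph f\<close> for all \<open>f\<close> close to \<open>g\<close>.
  As the Lipschitz functions are dense, \<open>H\<^sup>s(graph f) = 0\<close> for the generic \<open>f\<close>. It suffices to use
  countably many exponents \<open>s\<close> that approximate \<open>dim K\<close>.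
\<close>

section \<open>Hausdorff null sets\<close>

lemma diameter_le_if_dist_le:
  fixes S :: "'a::metric_space set"
  assumes "0 \<le> d" "\<And>x y. x \<in> S \<Longrightarrow> y \<in> S \<Longrightarrow> dist x y \<le> d"
  shows "diameter S \<le> d"
  using assms by (auto simp: diameter_def intro: cSUP_least)

lemma bounded_if_dist_le:
  fixes S :: "'a::metric_space set"
  assumes "\<And>x y. x \<in> S \<Longrightarrow> y \<in> S \<Longrightarrow> dist x y \<le> d"
  shows "bounded S"
  by (metis assms bounded_def bounded_empty ex_in_conv)

lemma diam_powr_nonneg: "0 \<le> diam_powr s U"
  by (simp add: diam_powr_def)

lemma hausdorff_premeasure_le:
  assumes "A \<subseteq> (\<Union>n. U n)" "\<And>n. bounded (U n)" "\<And>n. diameter (U n) \<le> \<delta>"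
  shows "hausdorff_premeasure s \<delta> A \<le> (\<Sum>n. ennreal (diam_powr s (U n)))"
  unfolding hausdorff_premeasure_def by (rule INF_lower) (use assms in auto)

lemma hausdorff_premeasure_lessE:
  assumes "hausdorff_premeasure s \<delta> A < c"
  obtains U :: "nat \<Rightarrow> 'a::metric_space set"
    where "A \<subseteq> (\<Union>n. U n)" "\<And>n. bounded (U n)" "\<And>n. diameter (U n) \<le> \<delta>"
      "(\<Sum>n. ennreal (diam_powr s (U n))) < c"
  using assms unfolding hausdorff_premeasure_def INF_less_iff by blast

lemma hausdorff_premeasure_mono:
  "A \<subseteq> B \<Longrightarrow> hausdorff_premeasure s \<delta> A \<le> hausdorff_premeasure s \<delta> B"
  unfolding hausdorff_premeasure_def by (rule INF_superset_mono) auto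

lemma hausdorff_premeasure_antimono:
  "\<delta> \<le> \<epsilon> \<Longrightarrow> hausdorff_premeasure s \<epsilon> A \<le> hausdorff_premeasure s \<delta> A"
  unfolding hausdorff_premeasure_def by (rule INF_superset_mono) (auto intro: order_trans)

text \<open>One parameter bounds both the mesh and the Hausdorff sum. Enlarging it weakens both
  demands, so checking a sequence of parameters tending to 0 is enough.\<close>

lemma hausdorff_premeasure_less_mono:
  assumes "hausdorff_premeasure s \<delta> A < ennreal \<delta>" "\<delta> \<le> \<epsilon>"
  shows "hausdorff_premeasure s \<epsilon> A < ennreal \<epsilon>"
  using assms hausdorff_premeasure_antimono[of \<delta> \<epsilon> s A] ennreal_leI[of \<delta> \<epsilon>]
  by (meson le_less_trans less_le_trans)

text \<open>This merges the limit in the mesh and the smallness of the sum into one condition on a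
  single \<epsilon>, which can be tested on a neighbourhood of \<open>A\<close>.\<close>

lemma hausdorff_measure_eq_0_iff:
  "hausdorff_measure s A = 0 \<longleftrightarrow> (\<forall>\<epsilon>>0. hausdorff_premeasure s \<epsilon> A < ennreal \<epsilon>)"
proof
  assume "hausdorff_measure s A = 0"
  then have "hausdorff_premeasure s \<epsilon> A = 0" if "\<epsilon> > 0" for \<epsilon>
    using that SUP_upper[of \<epsilon> "{0<..}" "\<lambda>\<delta>. hausdorff_premeasure s \<delta> A"]
    by (simp add: hausdorff_measure_def)
  then show "\<forall>\<epsilon>>0. hausdorff_premeasure s \<epsilon> A < ennreal \<epsilon>"
    by simp
next
  assume R: "\<forall>\<epsilon>>0. hausdorff_premeasure s \<epsilon> A < ennreal \<epsilon>"
  have "hausdorff_premeasure s \<delta> A \<le> 0" if "\<delta> > 0" for \<delta>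
  proof (rule ennreal_le_epsilon)
    fix e :: real assume "0 < e"
    \<comment> \<open>The parameter \<open>min \<delta> e\<close> respects the mesh \<delta> and
      also keeps the sum below \<open>e\<close>.\<close>
    then have "hausdorff_premeasure s (min \<delta> e) A < ennreal (min \<delta> e)"
      using R that by simp
    then have "hausdorff_premeasure s \<delta> A < ennreal (min \<delta> e)"
      using hausdorff_premeasure_antimono[of "min \<delta> e" \<delta> s A] by simp
    also have "\<dots> \<le> ennreal e"
      by (rule ennreal_leI) simp
    finally show "hausdorff_premeasure s \<delta> A \<le> 0 + ennreal e"
      by simp
  qed
  then have "hausdorff_measure s A \<le> 0"
    unfolding hausdorff_measure_def by (intro SUP_least) auto
  then show "hausdorff_measure s A = 0"
    by simp
qed

lemma hausdorff_measure_eq_0_if_Suc: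
  assumes "\<And>n. hausdorff_premeasure s (1 / real (Suc n)) A < ennreal (1 / real (Suc n))"
  shows "hausdorff_measure s A = 0"
  unfolding hausdorff_measure_eq_0_iff
  by (metis assms hausdorff_premeasure_less_mono less_eq_real_def nat_approx_posE)

section \<open>Lipschitz images\<close>

lemma diameter_lipschitz_image_le:
  assumes "L-lipschitz_on A f" "U \<subseteq> A" "bounded U"
  shows "bounded (f ` U)" "diameter (f ` U) \<le> L * diameter U"
proof -
  have d: "dist x y \<le> L * diameter U" if xy: "x \<in> f ` U" "y \<in> f ` U" for x y
  proof -
    obtain a b where ab: "a \<in> U" "b \<in> U" "x = f a" "y = f b"
      using xy by blast
    then have "dist x y \<le> L * dist a b"
      using assms(2) lipschitz_onD[OF assms(1)] by auto
    also have "\<dots> \<le> L * diameter U"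
      using ab assms(2) diameter_bounded_bound[OF assms(3)] lipschitz_on_nonneg[OF assms(1)]
      by (intro mult_left_mono) auto
    finally show ?thesis .
  qed
  show "bounded (f ` U)"
    using d by (rule bounded_if_dist_le)
  show "diameter (f ` U) \<le> L * diameter U"
    using d lipschitz_on_nonneg[OF assms(1)] diameter_ge_0[OF assms(3)]
    by (intro diameter_le_if_dist_le mult_nonneg_nonneg)
qed

lemma diam_powr_lipschitz_image_le:
  assumes "L-lipschitz_on A f" "0 < L" "0 \<le> s" "bounded U"
  shows "diam_powr s (f ` (A \<inter> U)) \<le> L powr s * diam_powr s U"
\<comment> \<open>For \<open>s = 0\<close> both contributions only record nonemptiness, and
  \<open>L powr 0 = 1\<close> because \<open>L\<close> is positive.\<close>
proof (cases "A \<inter> U = {} \<or> s = 0")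
  case True
  then show ?thesis
    using \<open>0 < L\<close> by (auto simp: diam_powr_def)
next
  case False
  have b: "bounded (A \<inter> U)"
    using assms by (meson bounded_subset inf_le2)
  have "diameter (f ` (A \<inter> U)) \<le> L * diameter (A \<inter> U)"
    using diameter_lipschitz_image_le(2)[OF assms(1) _ b] by simp
  also have "\<dots> \<le> L * diameter U"
    using assms by (simp add: diameter_subset)
  finally have "diameter (f ` (A \<inter> U)) powr s \<le> (L * diameter U) powr s"
    using assms(3) diameter_ge_0 diameter_lipschitz_image_le(1)[OF assms(1) _ b]
    by (intro powr_mono2) auto
  then show ?thesis
    using False by (auto simp: diam_powr_def powr_mult)
qed

text \<open>An efficient cover of \<open>A\<close> is pushed forward, which costs a factor
  \<open>L\<close> in the diameters and \<open>L powr s\<close> in the sum. Its members are first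
  cut down to \<open>A\<close>, where the Lipschitz bound is available.\<close>

lemma hausdorff_null_lipschitz_image:
  assumes L: "L-lipschitz_on A f" "0 < L" and s: "0 \<le> s" and null: "hausdorff_measure s A = 0"
  shows "hausdorff_measure s (f ` A) = 0"
  unfolding hausdorff_measure_eq_0_iff
proof safe
  fix \<epsilon> :: real assume \<epsilon>: "0 < \<epsilon>"
  \<comment> \<open>The first term keeps the image diameters below \<epsilon>, the second the image
    sum.\<close>
  define d where "d = min (\<epsilon> / L) (\<epsilon> / L powr s)"
  have Ls: "0 < L powr s" using L by simp
  have d: "0 < d" "L * d \<le> \<epsilon>" "L powr s * d \<le> \<epsilon>"
    using \<epsilon> L Ls by (auto simp: d_def min_def field_simps)
  have "hausdorff_premeasure s d A < ennreal d"
    using null d unfolding hausdorff_measure_eq_0_iff by blast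
  then obtain U where U: "A \<subseteq> (\<Union>n. U n)" "\<And>n. bounded (U n)" "\<And>n. diameter (U n) \<le> d"
      and sum: "(\<Sum>n. ennreal (diam_powr s (U n))) < ennreal d"
    by (rule hausdorff_premeasure_lessE) blast
  have b: "bounded (A \<inter> U n)" for n
    using U(2) by (meson bounded_subset inf_le2)
  have diam: "diameter (f ` (A \<inter> U n)) \<le> \<epsilon>" for n
  proof -
    have "diameter (f ` (A \<inter> U n)) \<le> L * diameter (A \<inter> U n)"
      using diameter_lipschitz_image_le(2)[OF L(1) _ b] by simp
    also have "\<dots> \<le> L * d"
      using L U(2,3)[of n] by (meson diameter_subset inf_le2 less_imp_le mult_left_mono order_trans)
    finally show ?thesis
      using d by linarith
  qed
  have "hausdorff_premeasure s \<epsilon> (f ` A) \<le> (\<Sum>n. ennreal (diam_powr s (f ` (A \<inter> U n))))"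
  proof (rule hausdorff_premeasure_le)
    show "f ` A \<subseteq> (\<Union>n. f ` (A \<inter> U n))"
      using U(1) by blast
  qed (use diam diameter_lipschitz_image_le(1)[OF L(1) _ b] in auto)
  also have "\<dots> \<le> (\<Sum>n. ennreal (L powr s) * ennreal (diam_powr s (U n)))"
    using diam_powr_lipschitz_image_le[OF L s U(2)]
    by (intro suminf_le) (auto simp flip: ennreal_mult simp: diam_powr_nonneg intro!: ennreal_leI)
  also have "\<dots> = ennreal (L powr s) * (\<Sum>n. ennreal (diam_powr s (U n)))"
    by simp
  also have "\<dots> < ennreal (L powr s) * ennreal d"
    using sum Ls by (intro ennreal_mult_strict_left_mono) auto
  also have "\<dots> = ennreal (L powr s * d)"
    using d by (simp add: ennreal_mult)
  also have "\<dots> \<le> ennreal \<epsilon>"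
    using d by (intro ennreal_leI)
  finally show "hausdorff_premeasure s \<epsilon> (f ` A) < ennreal \<epsilon>" .
qed

text \<open>Every exponent for which \<open>A\<close> is null is one for which its image is null, so
  the infimum for the image runs over a larger set.\<close>

lemma hausdorff_dim_lipschitz_image_le:
  assumes "L-lipschitz_on A f" "0 < L"
  shows "hausdorff_dim (f ` A) \<le> hausdorff_dim A"
  using hausdorff_null_lipschitz_image[OF assms]
  by (auto simp: hausdorff_dim_def intro!: INF_superset_mono)

section \<open>Open neighbourhoods of null sets\<close>

text \<open>The union of the balls of radius \<open>r\<close> around points of \<open>U\<close> has
  diameter at most \<open>diameter U + 2 * r\<close>. For \<open>s > 0\<close> continuity of the
  power makes the extra cost small with \<open>r\<close>; for \<open>s = 0\<close> there is no extra
  cost.\<close>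

lemma diam_powr_thickening:
  fixes U :: "'a::metric_space set"
  assumes "bounded U" "0 \<le> s" "0 < \<epsilon>"
  obtains V where "open V" "U \<subseteq> V" "bounded V" "diameter V \<le> diameter U + \<epsilon>"
    "diam_powr s V \<le> diam_powr s U + \<epsilon>"
proof -
  have "\<exists>r>0. 2 * r \<le> \<epsilon> \<and> (s = 0 \<or> (diameter U + 2 * r) powr s \<le> diameter U powr s + \<epsilon>)"
  proof (cases "s = 0")
    case True
    then show ?thesis
      using assms by (intro exI[of _ "\<epsilon> / 2"]) auto
  next
    case False
    \<comment> \<open>Here \<open>diameter U\<close> may be 0. A power with positive exponent is
      continuous there along nonnegative bases, hence the limit from the right.\<close>
    have "((\<lambda>r. (diameter U + 2 * r) powr s) \<longlongrightarrow> (diameter U + 2 * 0) powr s) (at_right 0)"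
      using False assms diameter_ge_0[OF assms(1)]
      by (intro tendsto_intros) (auto simp: eventually_at_right_less intro!: eventually_at_rightI[of 0 1])
    then have "\<forall>\<^sub>F r in at_right 0. (diameter U + 2 * r) powr s < diameter U powr s + \<epsilon>"
      using assms by (intro order_tendstoD) auto
    moreover have "\<forall>\<^sub>F r in at_right 0. 0 < r \<and> r < \<epsilon> / 2"
      using assms by (intro eventually_at_rightI[of 0 "\<epsilon> / 2"]) auto
    ultimately have "\<forall>\<^sub>F r in at_right 0. 0 < r \<and> 2 * r \<le> \<epsilon> \<and>
        (diameter U + 2 * r) powr s \<le> diameter U powr s + \<epsilon>"
      by eventually_elim auto
    from eventually_happens'[OF _ this] show ?thesis
      by auto
  qed
  then obtain r where r: "0 < r" "2 * r \<le> \<epsilon>"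
      and rs: "s = 0 \<or> (diameter U + 2 * r) powr s \<le> diameter U powr s + \<epsilon>"
    by blast
  define V where "V = (\<Union>x\<in>U. ball x r)"
  have d: "dist x y \<le> diameter U + 2 * r" if xy: "x \<in> V" "y \<in> V" for x y
  proof -
    obtain a b where "a \<in> U" "b \<in> U" "dist a x < r" "dist b y < r"
      using xy by (auto simp: V_def)
    moreover from this have "dist a b \<le> diameter U"
      using assms diameter_bounded_bound by blast
    ultimately show ?thesis
      by (smt (verit) dist_commute dist_triangle)
  qed
  have b: "bounded V"
    using d by (rule bounded_if_dist_le)
  have diam: "diameter V \<le> diameter U + 2 * r"
    using d r diameter_ge_0[OF assms(1)] by (intro diameter_le_if_dist_le) auto
  have "diam_powr s V \<le> diam_powr s U + \<epsilon>"
  proof (cases "U = {} \<or> s = 0")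
    case True
    then show ?thesis
      using assms by (auto simp: diam_powr_def V_def)
  next
    case False
    have "diameter V powr s \<le> (diameter U + 2 * r) powr s"
      using diam assms diameter_ge_0[OF b] by (intro powr_mono2) auto
    then show ?thesis
      using False rs assms by (auto simp: diam_powr_def)
  qed
  then show thesis
    using b diam r by (intro that[of V]) (auto simp: V_def)
qed

text \<open>Half of \<epsilon> is spent on a cover of \<open>A\<close>, the other half on thickening
  its members to open sets. Their union \<open>W\<close> is covered by these same sets.\<close>

lemma hausdorff_null_open_superset:
  assumes null: "hausdorff_measure s A = 0" and s: "0 \<le> s" and \<epsilon>: "0 < \<epsilon>"
  obtains W where "open W" "A \<subseteq> W" "hausdorff_premeasure s \<epsilon> W < ennreal \<epsilon>"
proof -
  have "hausdorff_premeasure s (\<epsilon> / 2) A < ennreal (\<epsilon> / 2)"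
    using null \<epsilon> unfolding hausdorff_measure_eq_0_iff by simp
  then obtain U where U: "A \<subseteq> (\<Union>n. U n)" "\<And>n. bounded (U n)" "\<And>n. diameter (U n) \<le> \<epsilon> / 2"
      and sum: "(\<Sum>n. ennreal (diam_powr s (U n))) < ennreal (\<epsilon> / 2)"
    by (rule hausdorff_premeasure_lessE) blast
  \<comment> \<open>The errors add up to \<open>\<epsilon> / 2\<close> for the sum, and each is at
    most \<open>\<epsilon> / 2\<close>, which keeps the diameters below \<epsilon>.\<close>
  define e where "e n = (1/2) ^ Suc n * (\<epsilon> / 2)" for n
  have e: "0 < e n" "e n \<le> \<epsilon> / 2" for n
    using \<epsilon> power_le_one[of "1/2::real" "Suc n"] by (auto simp: e_def field_simps)
  have esum: "(\<Sum>n. ennreal (e n)) = ennreal (\<epsilon> / 2)"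
    using sums_mult2[OF power_half_series, of "\<epsilon> / 2"] \<epsilon>
    by (intro suminf_ennreal_eq) (auto simp: e_def)
  have "\<exists>V. open V \<and> U n \<subseteq> V \<and> bounded V \<and> diameter V \<le> diameter (U n) + e n \<and>
      diam_powr s V \<le> diam_powr s (U n) + e n" for n
    by (rule diam_powr_thickening[OF U(2)[of n] s e(1)[of n]]) blast
  then obtain V where V: "\<And>n. open (V n)" "\<And>n. U n \<subseteq> V n" "\<And>n. bounded (V n)"
      "\<And>n. diameter (V n) \<le> diameter (U n) + e n"
      "\<And>n. diam_powr s (V n) \<le> diam_powr s (U n) + e n"
    by metis
  have "hausdorff_premeasure s \<epsilon> (\<Union>n. V n) \<le> (\<Sum>n. ennreal (diam_powr s (V n)))"
  proof (rule hausdorff_premeasure_le)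
    show "diameter (V n) \<le> \<epsilon>" for n
      using V(4)[of n] U(3)[of n] e(2)[of n] by linarith
  qed (use V in auto)
  also have "\<dots> \<le> (\<Sum>n. ennreal (e n) + ennreal (diam_powr s (U n)))"
    using V(5) e(1) by (intro suminf_le)
      (auto simp flip: ennreal_plus simp: diam_powr_nonneg less_imp_le add.commute intro!: ennreal_leI)
  also have "\<dots> = ennreal (\<epsilon> / 2) + (\<Sum>n. ennreal (diam_powr s (U n)))"
    by (subst suminf_add[symmetric]) (simp_all add: esum)
  also have "\<dots> < ennreal (\<epsilon> / 2) + ennreal (\<epsilon> / 2)"
    using sum by (simp only: ennreal_add_left_cancel_less infinity_ennreal_def ennreal_neq_top simp_thms)
  also have "\<dots> = ennreal \<epsilon>"
    using \<epsilon> by (simp flip: ennreal_plus)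
  finally have "hausdorff_premeasure s \<epsilon> (\<Union>n. V n) < ennreal \<epsilon>" .
  then show thesis
    using U(1) V(1,2) by (intro that[of "\<Union>n. V n"]) blast+
qed

section \<open>Generic continuous functions\<close>

lemma mspace_C_metric:
  assumes "compact K"
  shows "mspace (C_metric K) = {f \<in> extensional K. continuous_on K f}"
  using assms
  by (auto simp: C_metric_def compactin_mspace_cfunspace compactin_subtopology simp del: mspace_cfunspace)

lemma C_metric_dist_less:
  assumes "compact K" "f \<in> mspace (C_metric K)" "g \<in> mspace (C_metric K)"
    "mdist (C_metric K) f g < e" "x \<in> K"
  shows "dist (f x) (g x) < e"
  using assms cfunspace_mdist_lt[of "top_of_set K" f euclidean_metric g e x]
  by (simp add: C_metric_def compactin_subtopology del: mspace_cfunspace)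

lemma C_metric_dist_le:
  assumes "0 \<le> e" "\<And>x. x \<in> K \<Longrightarrow> dist (f x) (g x) \<le> e"
  shows "mdist (C_metric K) f g \<le> e"
  using assms unfolding C_metric_def by (intro mdist_cfunspace_le) auto

text \<open>Both factors are bounded on the compact set, so the product rule for differences gives a
  Lipschitz constant. This supplies the closure under products in the Stone-Weierstrass
  theorem.\<close>

lemma lipschitz_on_mult_compact:
  fixes f g :: "'a::metric_space \<Rightarrow> real"
  assumes "compact K" and f: "C-lipschitz_on K f" and g: "D-lipschitz_on K g"
  shows "\<exists>E. E-lipschitz_on K (\<lambda>x. f x * g x)"
proof -
  have "bounded (h ` K)" if "L-lipschitz_on K h" for L and h :: "'a \<Rightarrow> real"
    using lipschitz_on_continuous_on[OF that] assms(1)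
    by (intro compact_imp_bounded compact_continuous_image)
  from this[OF f] this[OF g] obtain M N
    where M: "\<forall>x\<in>K. \<bar>f x\<bar> \<le> M" and N: "\<forall>x\<in>K. \<bar>g x\<bar> \<le> N"
    by (auto simp: bounded_iff)
  \<comment> \<open>The absolute values keep the constant nonnegative even if \<open>K\<close> is
    empty and the bounds \<open>M\<close> and \<open>N\<close> are arbitrary.\<close>
  have "dist (f x * g x) (f y * g y) \<le> (\<bar>M\<bar> * D + \<bar>N\<bar> * C) * dist x y" if xy: "x \<in> K" "y \<in> K" for x y
  proof -
    have "f x * g x - f y * g y = f x * (g x - g y) + g y * (f x - f y)"
      by (simp add: algebra_simps)
    then have "dist (f x * g x) (f y * g y) \<le> \<bar>f x\<bar> * dist (g x) (g y) + \<bar>g y\<bar> * dist (f x) (f y)"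
      using abs_triangle_ineq[of "f x * (g x - g y)" "g y * (f x - f y)"]
      by (simp add: dist_real_def abs_mult)
    also have "\<dots> \<le> \<bar>M\<bar> * (D * dist x y) + \<bar>N\<bar> * (C * dist x y)"
      using bspec[OF M xy(1)] bspec[OF N xy(2)] lipschitz_onD[OF f xy] lipschitz_onD[OF g xy]
      by (intro add_mono mult_mono) simp_all
    finally show ?thesis
      by (simp add: algebra_simps)
  qed
  then have "(\<bar>M\<bar> * D + \<bar>N\<bar> * C)-lipschitz_on K (\<lambda>x. f x * g x)"
    using lipschitz_on_nonneg[OF f] lipschitz_on_nonneg[OF g] by (intro lipschitz_onI) auto
  then show ?thesis
    by blast
qed

text \<open>By Stone-Weierstrass: the Lipschitz functions on \<open>K\<close> form an algebra with
  constants, and the distance to \<open>x\<close> separates \<open>x\<close> from any other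
  point.\<close>

lemma lipschitz_dense:
  fixes f :: "'a::metric_space \<Rightarrow> real"
  assumes K: "compact K" and f: "continuous_on K f" and e: "0 < e"
  obtains g C where "C-lipschitz_on K g" "\<And>x. x \<in> K \<Longrightarrow> \<bar>f x - g x\<bar> < e"
proof -
  have "\<exists>g. (\<exists>C. C-lipschitz_on K g) \<and> (\<forall>x\<in>K. \<bar>f x - g x\<bar> < e)"
  proof (rule Stone_Weierstrass_HOL[OF K _ _ _ _ _ f e])
    show "\<exists>C. C-lipschitz_on K (\<lambda>x. c)" for c :: real
      using lipschitz_on_constant by blast
    show "\<exists>C. C-lipschitz_on K (\<lambda>x. g x + h x)"
      if "(\<exists>C. C-lipschitz_on K g) \<and> (\<exists>C. C-lipschitz_on K h)" for g h :: "'a \<Rightarrow> real"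
      using that lipschitz_on_add by blast
    show "\<exists>C. C-lipschitz_on K (\<lambda>x. g x * h x)"
      if "(\<exists>C. C-lipschitz_on K g) \<and> (\<exists>C. C-lipschitz_on K h)" for g h :: "'a \<Rightarrow> real"
      using that lipschitz_on_mult_compact[OF K] by blast
    show "\<exists>g. (\<exists>C. C-lipschitz_on K g) \<and> g x \<noteq> (g y :: real)"
      if "x \<in> K \<and> y \<in> K \<and> x \<noteq> y" for x y
    proof (intro exI conjI)
      show "1-lipschitz_on K (dist x)"
        by (rule lipschitz_onI) (metis abs_dist_diff_le dist_commute dist_real_def mult_1, simp)
      show "dist x x \<noteq> dist x y"
        using that by simp
    qed
  qed (use lipschitz_on_continuous_on in blast)
  then show thesis
    using that by blast
qed

section \<open>Nowhere dense and meagre sets\<close>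

lemma nowhere_dense_in_subset:
  "nowhere_dense_in X T \<Longrightarrow> S \<subseteq> T \<Longrightarrow> nowhere_dense_in X S"
  unfolding nowhere_dense_in_def
  using interior_of_mono[OF closure_of_mono[of S T X], of X] by auto

text \<open>The definition of \<open>meagre_in\<close> asks for an exact union over the naturals.
  Intersecting with \<open>S\<close> and reindexing reduces this to a cover over any countable type,
  such as pairs of naturals.\<close>

lemma meagre_in_subset_UN:
  fixes B :: "'i::countable \<Rightarrow> 'a set"
  assumes "\<And>i. nowhere_dense_in X (B i)" "S \<subseteq> (\<Union>i. B i)"
  shows "meagre_in X S"
  unfolding meagre_in_def
proof (intro exI conjI allI)
  show "nowhere_dense_in X (S \<inter> B (from_nat n))" for n
    using assms(1) by (rule nowhere_dense_in_subset) auto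
  have "x \<in> (\<Union>n. B (from_nat n))" if "x \<in> S" for x
  proof -
    obtain i where "x \<in> B i"
      using assms(2) \<open>x \<in> S\<close> by blast
    then have "x \<in> B (from_nat (to_nat i))"
      by simp
    then show ?thesis
      by blast
  qed
  then show "S = (\<Union>n. S \<inter> B (from_nat n))"
    by blast
qed

text \<open>If the closure of \<open>B\<close> had interior, some open \<open>V\<close> would meet
  that interior while missing \<open>B\<close>, but an open set that meets the closure of
  \<open>B\<close> meets \<open>B\<close>.\<close>

lemma nowhere_dense_in_if_dense_open_disjoint:
  assumes "B \<subseteq> topspace X"
    and dense: "\<And>U. openin X U \<Longrightarrow> U \<noteq> {} \<Longrightarrow> \<exists>V. openin X V \<and> V \<inter> U \<noteq> {} \<and> V \<inter> B = {}"
  shows "nowhere_dense_in X B"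
  unfolding nowhere_dense_in_def
proof (intro conjI assms(1) notI equals0I)
  fix x assume "x \<in> X interior_of (X closure_of B)"
  then obtain V where V: "openin X V" "V \<inter> X interior_of (X closure_of B) \<noteq> {}" "V \<inter> B = {}"
    using dense openin_interior_of by (metis empty_iff)
  then obtain y where "y \<in> V" "y \<in> X closure_of B"
    using interior_of_subset by fastforce
  with V show False
    unfolding in_closure_of by blast
qed

lemma openin_mball_of: "openin (mtopology_of m) (mball_of m x r)"
  unfolding mball_of_def mtopology_of_def
  by (rule Metric_space.openin_mball[OF Metric_space_mspace_mdist])

lemma openin_mtopology_of:
  "openin (mtopology_of m) U \<longleftrightarrow> U \<subseteq> mspace m \<and> (\<forall>x\<in>U. \<exists>r>0. mball_of m x r \<subseteq> U)"
  by (simp add: mball_of_def mtopology_of_def Ball_def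
      Metric_space.openin_mtopology[OF Metric_space_mspace_mdist])

section \<open>Graphs of generic functions\<close>

lemma graph_on_eq_image: "graph_on K f = (\<lambda>x. (x, f x)) ` K"
  by (auto simp: graph_on_def)

lemma hausdorff_dim_graph_ge: "hausdorff_dim K \<le> hausdorff_dim (graph_on K f)"
proof -
  have "1-lipschitz_on (graph_on K f) fst"
    by (rule lipschitz_onI) (simp_all add: dist_fst_le)
  from hausdorff_dim_lipschitz_image_le[OF this] show ?thesis
    by (simp add: graph_on_eq_image image_image)
qed

text \<open>Any nonempty open set contains a Lipschitz \<open>g\<close>, and a whole ball around
  \<open>g\<close> avoids the exceptional set. This treats one exponent and one threshold at a
  time.\<close>

lemma nowhere_dense_large_graph_premeasure:
  fixes K :: "'a::metric_space set"
  assumes K: "compact K" and s: "0 \<le> s" and null: "hausdorff_measure s K = 0" and \<epsilon>: "0 < \<epsilon>"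
  shows "nowhere_dense_in (mtopology_of (C_metric K))
    {f \<in> mspace (C_metric K). \<not> hausdorff_premeasure s \<epsilon> (graph_on K f) < ennreal \<epsilon>}"
    (is "nowhere_dense_in ?X ?B")
proof (rule nowhere_dense_in_if_dense_open_disjoint)
  fix U assume U: "openin ?X U" "U \<noteq> {}"
  then obtain f r where f: "f \<in> U" "f \<in> mspace (C_metric K)" and r: "0 < r" "mball_of (C_metric K) f r \<subseteq> U"
    unfolding openin_mtopology_of by blast
  have "continuous_on K f"
    using f mspace_C_metric[OF K] by auto
  \<comment> \<open>Pointwise bounds give only a weak inequality for the supremum distance, so
    \<open>r / 2\<close> is used to stay strictly inside the ball of radius
    \<open>r\<close>.\<close>
  from this half_gt_zero[OF r(1)] obtain g0 C where "C-lipschitz_on K g0" and fg0: "\<And>x. x \<in> K \<Longrightarrow> \<bar>f x - g0 x\<bar> < r / 2"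
    by (rule lipschitz_dense[OF K]) blast
  \<comment> \<open>Points of C(K) must be \<open>undefined\<close> outside
    \<open>K\<close>.\<close>
  define g where "g = restrict g0 K"
  have lip: "C-lipschitz_on K g"
    using \<open>C-lipschitz_on K g0\<close> by (simp add: g_def cong: lipschitz_on_cong)
  have g: "g \<in> mspace (C_metric K)"
    using lipschitz_on_continuous_on[OF lip] by (simp add: mspace_C_metric[OF K] g_def)
  have "mdist (C_metric K) f g \<le> r / 2"
    using fg0 r by (intro C_metric_dist_le) (auto simp: g_def dist_real_def less_imp_le)
  then have gU: "g \<in> U"
    using f g r by auto
  have lipgraph: "(sqrt (1\<^sup>2 + C\<^sup>2))-lipschitz_on K (\<lambda>x. (x, g x))"
    by (intro lipschitz_on_Pair lipschitz_on_id lip)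
  have "0 < sqrt (1\<^sup>2 + C\<^sup>2)"
    by (simp add: add_pos_nonneg)
  then have "hausdorff_measure s (graph_on K g) = 0"
    unfolding graph_on_eq_image by (rule hausdorff_null_lipschitz_image[OF lipgraph _ s null])
  then obtain W where W: "open W" "graph_on K g \<subseteq> W" "hausdorff_premeasure s \<epsilon> W < ennreal \<epsilon>"
    using s \<epsilon> by (rule hausdorff_null_open_superset)
  have "compact (graph_on K g)"
    unfolding graph_on_eq_image
    by (rule compact_continuous_image[OF lipschitz_on_continuous_on[OF lipgraph] K])
  \<comment> \<open>Compactness of the graph gives one radius \<open>e\<close> that works at all its
    points.\<close>
  then obtain e where e: "0 < e" "(\<Union>z\<in>graph_on K g. ball z e) \<subseteq> W"
    using W compact_subset_open_imp_ball_epsilon_subset by metis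
  have small: "hausdorff_premeasure s \<epsilon> (graph_on K h) < ennreal \<epsilon>"
    if h: "h \<in> mball_of (C_metric K) g e" for h
  proof -
    \<comment> \<open>The two points share their first coordinate, so their distance is that of
      \<open>g x\<close> and \<open>h x\<close>.\<close>
    have "(x, h x) \<in> ball (x, g x) e" if "x \<in> K" for x
      using C_metric_dist_less[OF K, of g h e x] h that by (simp add: dist_Pair_Pair)
    then have "graph_on K h \<subseteq> W"
      using e(2) unfolding graph_on_eq_image by blast
    then show ?thesis
      using W(3) hausdorff_premeasure_mono le_less_trans by blast
  qed
  show "\<exists>V. openin ?X V \<and> V \<inter> U \<noteq> {} \<and> V \<inter> ?B = {}"
  proof (intro exI conjI)
    show "openin ?X (mball_of (C_metric K) g e)"
      by (rule openin_mball_of)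
    have "g \<in> mball_of (C_metric K) g e"
      using g e C_metric_dist_le[of 0 K g g] by simp
    then show "mball_of (C_metric K) g e \<inter> U \<noteq> {}"
      using gU by blast
    show "mball_of (C_metric K) g e \<inter> ?B = {}"
      using small by blast
  qed
qed auto

text \<open>The infimum defining the dimension need not be attained, but an infimum of a nonempty
  set of extended reals is the infimum of a sequence in it. Countability is what lets the
  exceptional sets be united to a meagre set.\<close>

lemma hausdorff_dim_countable_exponents:
  assumes "hausdorff_dim A < \<infinity>" "A \<noteq> {}"
  obtains s :: "nat \<Rightarrow> real" where "\<And>k. 0 \<le> s k" "\<And>k. hausdorff_measure (s k) A = 0"
    "hausdorff_dim A = (INF k. ereal (s k))"
proof -
  let ?S = "{s::real. 0 \<le> s \<and> hausdorff_measure s A = 0}"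
  have dim: "hausdorff_dim A = Inf (ereal ` ?S)"
    using assms by (simp add: hausdorff_dim_def)
  \<comment> \<open>Otherwise the infimum would be \<infinity>, against the finite
    dimension.\<close>
  have "ereal ` ?S \<noteq> {}"
  proof
    assume "ereal ` ?S = {}"
    then show False
      using dim assms(1) unfolding \<open>ereal ` ?S = {}\<close> by (simp add: top_ereal_def)
  qed
  then obtain t :: "nat \<Rightarrow> ereal" where t: "range t \<subseteq> ereal ` ?S" "Inf (ereal ` ?S) = (INF k. t k)"
    using Inf_countable_INF[of "ereal ` ?S"] by blast
  define s where "s k = real_of_ereal (t k)" for k
  have s: "s k \<in> ?S" "t k = ereal (s k)" for k
  proof -
    have "t k \<in> ereal ` ?S"
      using t(1) by (rule subsetD) simp
    then show "s k \<in> ?S" "t k = ereal (s k)"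
      by (auto simp: s_def)
  qed
  show thesis
  proof (rule that)
    show "0 \<le> s k" "hausdorff_measure (s k) A = 0" for k
      using s(1)[of k] by simp_all
    show "hausdorff_dim A = (INF k. ereal (s k))"
      unfolding dim t(2) s(2) ..
  qed
qed

theorem theorem5p2:
  fixes K :: "'a::metric_space set"
  assumes "compact K"
  shows "generic_in_C K (\<lambda>f. hausdorff_dim (graph_on K f) = hausdorff_dim K)"
proof -
  let ?X = "mtopology_of (C_metric K)"
  let ?bad = "{f \<in> mspace (C_metric K). hausdorff_dim (graph_on K f) \<noteq> hausdorff_dim K}"
  have "meagre_in ?X ?bad"
  \<comment> \<open>In these cases no function is exceptional: either both dimensions are -1, or the
    projection forces the graph to have infinite dimension too.\<close>
  proof (cases "K = {} \<or> hausdorff_dim K = \<infinity>")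
    case True
    then have "hausdorff_dim (graph_on K f) = hausdorff_dim K" for f
    proof
      assume "K = {}"
      then show ?thesis
        by (simp add: hausdorff_dim_def graph_on_def)
    next
      assume "hausdorff_dim K = \<infinity>"
      then show ?thesis
        using hausdorff_dim_graph_ge[of K f] by simp
    qed
    then have "?bad \<subseteq> (\<Union>i::nat. {})"
      by simp
    then show ?thesis
      by (rule meagre_in_subset_UN[rotated]) (simp add: nowhere_dense_in_def)
  next
    case False
    then obtain s :: "nat \<Rightarrow> real" where s: "\<And>k. 0 \<le> s k" "\<And>k. hausdorff_measure (s k) K = 0"
        and dim: "hausdorff_dim K = (INF k. ereal (s k))"
      using hausdorff_dim_countable_exponents[of K] by auto
    \<comment> \<open>The first index runs through the exponents, the second through the thresholds
      \<open>1 / real (Suc n)\<close>.\<close>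
    define B where "B = (\<lambda>(k, n). {f \<in> mspace (C_metric K).
      \<not> hausdorff_premeasure (s k) (1 / real (Suc n)) (graph_on K f) < ennreal (1 / real (Suc n))})"
    show ?thesis
    proof (rule meagre_in_subset_UN)
      show "nowhere_dense_in ?X (B i)" for i
        unfolding B_def
        by (cases i) (simp only: prod.case,
          intro nowhere_dense_large_graph_premeasure assms s, simp)
      show "?bad \<subseteq> (\<Union>i. B i)"
      proof (rule subsetI, rule ccontr)
        fix f assume f: "f \<in> ?bad" "f \<notin> (\<Union>i. B i)"
        then have "hausdorff_premeasure (s k) (1 / real (Suc n)) (graph_on K f)
            < ennreal (1 / real (Suc n))" for k n
          by (auto simp: B_def simp del: of_nat_Suc)
        \<comment> \<open>Passing all thresholds for a fixed \<open>k\<close> makes the graph null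
          for \<open>s k\<close>, so each \<open>s k\<close> bounds its dimension from
          above.\<close>
        then have "hausdorff_measure (s k) (graph_on K f) = 0" for k
          by (rule hausdorff_measure_eq_0_if_Suc)
        then have "hausdorff_dim (graph_on K f) \<le> hausdorff_dim K"
          unfolding dim using False s(1)
          by (auto simp: hausdorff_dim_def graph_on_def intro!: INF_greatest INF_lower)
        then show False
          using f hausdorff_dim_graph_ge[of K f] by auto
      qed
    qed
  qed
  moreover have "topspace ?X - {f \<in> mspace (C_metric K). hausdorff_dim (graph_on K f) = hausdorff_dim K} = ?bad"
    by auto
  ultimately show ?thesis
    by (auto simp: generic_in_C_def comeagre_in_def)
qed

end
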